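(* Let $\mathbf a(\theta_0),\mathbf a(\theta_k)\in\mathbb C^N$ be the steering vectors of the beam axis $\theta_0$ and of the controlled angle $\theta_k$, and let $\mathbf w_{k-1}\in\mathbb C^N$, $\theta_k$ and $\rho_k\in[0,1]$ be given. With the notation of the context, and $\mathbf B_k(2,2)\neq0$: 1. $T(\beta_{k,\star})=\mu_{k,s}=\mu_{k,\star}$ if and only if $\mathbf c_{\beta_k}(2)=0$ and $\mathbf c_{\beta_k}(1)\in[0,1]$. 2. $T(\beta_{k,\star})=\mu_{k,l}$ if and only if $\mathbf c_{\beta_k}(2)=0$ and $\mathbf c_{\beta_k}(1)\in(-\infty,0)\cup(1,+\infty)$. 3. If $T(\beta_{k,\star})\in\{\mu_{k,s},\mu_{k,l}\}$, then $\beta_{k,\star}\in\mathbb R$.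
   Context: $j=\sqrt{-1}$; $(\cdot)^H$ is conjugate transpose; $\angle z$ is the argument of $z$; $g(\mathbf c)=\mathbf c(1)+j\,\mathbf c(2)$ for a two-dimensional vector $\mathbf c$. The steering vector of an $N$-element array is $\mathbf a(\theta)=[g_1(\theta)e^{-j\omega\tau_1(\theta)},\dots,g_N(\theta)e^{-j\omega\tau_N(\theta)}]^T$, with $g_n$ the pattern of the $n$th element, $\tau_n$ its time delay relative to the reference point, and $\omega$ the operating frequency. $\mathrm C^2$-WORD quantities: $\mathbf w_\parallel=\dfrac{\mathbf a(\theta_k)\mathbf a^H(\theta_k)}{\mathbf a^H(\theta_k)\mathbf a(\theta_k)}\mathbf w_{k-1}$, $\mathbf w_\perp=\mathbf w_{k-1}-\mathbf w_\parallel$, $$\mathbf B_k=\begin{bmatrix}\mathbf w_\perp^H\mathbf a(\theta_k)\\ \mathbf w_\parallel^H\mathbf a(\theta_k)\end{bmatrix}\begin{bmatrix}\mathbf w_\perp^H\mathbf a(\theta_k)\\ \mathbf w_\parallel^H\mathbf a(\theta_k)\end{bmatrix}^H-\rho_k\begin{bmatrix}\mathbf w_\perp^H\mathbf a(\theta_0)\\ \mathbf w_\parallel^H\mathbf a(\theta_0)\end{bmatrix}\begin{bmatrix}\mathbf w_\perp^H\mathbf a(\theta_0)\\ \mathbf w_\parallel^H\mathbf a(\theta_0)\end{bmatrix}^H ,$$ $\mathbf c_{\beta_k}=\dfrac1{\mathbf B_k(2,2)}\begin{bmatrix}-\Re(\mathbf B_k(1,2))\\ \Im(\mathbf B_k(1,2))\end{bmatrix}$,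 $R_{\beta_k}=\dfrac{\sqrt{-\det\mathbf B_k}}{|\mathbf B_k(2,2)|}$, $\mathbb C_{\beta_k}=\{\beta_k\in\mathbb C:\|[\Re(\beta_k),\Im(\beta_k)]^T-\mathbf c_{\beta_k}\|_2=R_{\beta_k}\}$, and $$\beta_{k,\star}=\arg\max_{\beta_k\in\mathbb C_{\beta_k}}|\beta_k|=(\|\mathbf c_{\beta_k}\|_2+R_{\beta_k})e^{j\angle g(\mathbf c_{\beta_k})}.$$ The map $T$ is $$T(\beta_k)=\frac{(\beta_k-1)\,\mathbf a^H(\theta_k)\mathbf w_{k-1}}{\mathbf a^H(\theta_k)\mathbf a(\theta_k)},$$ so that $\mathbf w_\perp+\beta_k\mathbf w_\parallel=\mathbf w_{k-1}+T(\beta_k)\mathbf a(\theta_k)$; the $\mathrm C^2$-WORD update is $\mathbf w_k=\mathbf w_\perp+\beta_{k,\star}\mathbf w_\parallel$. $\mathrm A^2\mathrm{RC}$ quantities: the update is $\mathbf w_k=\mathbf w_{k-1}+\mu_{k,\star}\mathbf a(\theta_k)$, where $\mu_{k,\star}=\mu_{k,s}\triangleq\arg\min_{\mu_k\in\mathbb C_{\mu_k}}|\mu_k|$; also $\mu_{k,l}\triangleq\arg\max_{\mu_k\in\mathbb C_{\mu_k}}|\mu_k|$. Here $\mathbf Q_k=[\mathbf w_{k-1},\mathbf a(\theta_k)]^H\bigl(\mathbf a(\theta_k)\mathbf a^H(\theta_k)-\rho_k\mathbf a(\theta_0)\mathbf a^H(\theta_0)\bigr)[\mathbf w_{k-1},\mathbf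 a(\theta_k)]$, and $\mathbb C_{\mu_k}$ is the set of $\mu_k\in\mathbb C$ such that $[\Re(\mu_k),\Im(\mu_k)]^T$ lies on the circle with center $[-\Re(\mathbf Q_k(1,2)),\ \Im(\mathbf Q_k(1,2))]^T/\mathbf Q_k(2,2)$ and radius $\sqrt{-\det\mathbf Q_k}/|\mathbf Q_k(2,2)|$.
   Formalization: In item 2 the left side also requires μ_{k,l} ≠ μ_{k,s}: for ρ_k = 0 the circle is one point, so T(β_{k,⋆}) = μ_{k,l} although c_β(1) = 0. Where the minimiser or maximiser is not unique, equality with it is read as membership in the set of them. *)

theory Defs
  imports "HOL-Analysis.Analysis"
begin

text \<open>\<open>hdot x y\<close> is $x^H y$ (conjugate-linear in the first argument), and
  \<open>houter x y\<close> is the matrix $x y^H$.\<close>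

definition hdot :: "complex ^ 'n \<Rightarrow> complex ^ 'n \<Rightarrow> complex" where
  "hdot x y = (\<Sum>i\<in>UNIV. cnj (x $ i) * y $ i)"

definition houter :: "complex ^ 'm \<Rightarrow> complex ^ 'n \<Rightarrow> complex ^ 'n ^ 'm" where
  "houter x y = (\<chi> i j. x $ i * cnj (y $ j))"

definition htranspose :: "complex ^ 'n ^ 'm \<Rightarrow> complex ^ 'm ^ 'n" where
  "htranspose A = (\<chi> i j. cnj (A $ j $ i))"

definition columns2 :: "complex ^ 'n \<Rightarrow> complex ^ 'n \<Rightarrow> complex ^ 2 ^ 'n" where
  "columns2 x y = (\<chi> i. vector [x $ i, y $ i])"

definition steering ::
  "('n \<Rightarrow> real \<Rightarrow> complex) \<Rightarrow> ('n \<Rightarrow> real \<Rightarrow> real) \<Rightarrow> real \<Rightarrow> real \<Rightarrow> complex ^ 'n" where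
  "steering g \<tau> \<omega> \<theta> = (\<chi> n. g n \<theta> * exp (- \<i> * complex_of_real (\<omega> * \<tau> n \<theta>)))"

definition to_complex :: "real ^ 2 \<Rightarrow> complex" where
  "to_complex c = Complex (c $ 1) (c $ 2)"

text \<open>The circle attached to a \<open>2 \<times> 2\<close> matrix \<open>H\<close>. It is only used for Hermitian
  \<open>H\<close>, for which \<open>H $ 2 $ 2\<close> and \<open>det H\<close> are real; \<open>Re\<close> merely changes the type there.\<close>

definition circle_center :: "complex ^ 2 ^ 2 \<Rightarrow> real ^ 2" where
  "circle_center H = (1 / Re (H $ 2 $ 2)) *\<^sub>R vector [- Re (H $ 1 $ 2), Im (H $ 1 $ 2)]"

definition circle_radius :: "complex ^ 2 ^ 2 \<Rightarrow> real" where
  "circle_radius H = sqrt (- Re (det H)) / cmod (H $ 2 $ 2)"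

definition circle_set :: "complex ^ 2 ^ 2 \<Rightarrow> complex set" where
  "circle_set H = {z. norm ((vector [Re z, Im z] :: real ^ 2) - circle_center H) = circle_radius H}"

text \<open>Below, \<open>a0\<close> and \<open>ak\<close> are the steering vectors of the beam axis and of the controlled
  angle, \<open>w\<close> is the previous weight vector and \<open>\<rho>\<close> the prescribed level.\<close>

definition w_par :: "complex ^ 'n \<Rightarrow> complex ^ 'n \<Rightarrow> complex ^ 'n" where
  "w_par ak w = (1 / hdot ak ak) *s (houter ak ak *v w)"

definition w_perp :: "complex ^ 'n \<Rightarrow> complex ^ 'n \<Rightarrow> complex ^ 'n" where
  "w_perp ak w = w - w_par ak w"

definition B_mat ::
  "complex ^ 'n \<Rightarrow> complex ^ 'n \<Rightarrow> complex ^ 'n \<Rightarrow> real \<Rightarrow> complex ^ 2 ^ 2" where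
  "B_mat a0 ak w \<rho> =
    (let bk = vector [hdot (w_perp ak w) ak, hdot (w_par ak w) ak];
         b0 = vector [hdot (w_perp ak w) a0, hdot (w_par ak w) a0]
     in houter bk bk - \<rho> *\<^sub>R houter b0 b0)"

definition c_beta :: "complex ^ 'n \<Rightarrow> complex ^ 'n \<Rightarrow> complex ^ 'n \<Rightarrow> real \<Rightarrow> real ^ 2" where
  "c_beta a0 ak w \<rho> = circle_center (B_mat a0 ak w \<rho>)"

definition R_beta :: "complex ^ 'n \<Rightarrow> complex ^ 'n \<Rightarrow> complex ^ 'n \<Rightarrow> real \<Rightarrow> real" where
  "R_beta a0 ak w \<rho> = circle_radius (B_mat a0 ak w \<rho>)"

definition C_beta :: "complex ^ 'n \<Rightarrow> complex ^ 'n \<Rightarrow> complex ^ 'n \<Rightarrow> real \<Rightarrow> complex set" where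
  "C_beta a0 ak w \<rho> = circle_set (B_mat a0 ak w \<rho>)"

text \<open>\<open>beta_star\<close> is the point of largest modulus on \<open>C_beta\<close> (see
  \<open>beta_star_is_arg_max\<close>). If the circle is centred at the origin, every point has the same
  modulus; the closed formula then selects \<open>R_beta\<close>, because \<open>Arg 0 = 0\<close>.\<close>

definition beta_star :: "complex ^ 'n \<Rightarrow> complex ^ 'n \<Rightarrow> complex ^ 'n \<Rightarrow> real \<Rightarrow> complex" where
  "beta_star a0 ak w \<rho> =
    complex_of_real (norm (c_beta a0 ak w \<rho>) + R_beta a0 ak w \<rho>)
      * exp (\<i> * complex_of_real (Arg (to_complex (c_beta a0 ak w \<rho>))))"

definition T_map :: "complex ^ 'n \<Rightarrow> complex ^ 'n \<Rightarrow> complex \<Rightarrow> complex" where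
  "T_map ak w \<beta> = (\<beta> - 1) * hdot ak w / hdot ak ak"

definition Q_mat ::
  "complex ^ 'n \<Rightarrow> complex ^ 'n \<Rightarrow> complex ^ 'n \<Rightarrow> real \<Rightarrow> complex ^ 2 ^ 2" where
  "Q_mat a0 ak w \<rho> =
    htranspose (columns2 w ak) ** (houter ak ak - \<rho> *\<^sub>R houter a0 a0) ** columns2 w ak"

definition C_mu :: "complex ^ 'n \<Rightarrow> complex ^ 'n \<Rightarrow> complex ^ 'n \<Rightarrow> real \<Rightarrow> complex set" where
  "C_mu a0 ak w \<rho> = circle_set (Q_mat a0 ak w \<rho>)"

text \<open>The minimiser and the maximiser of the modulus on \<open>C_mu\<close> need not be unique: if the circle
  is centred at the origin, each of its points is both. They are therefore taken as sets, and
  an equation \<open>\<mu> = arg min\<close> is read as membership. By \<open>mu_s_mu_l_singletons\<close> the two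
  sets are distinct singletons unless they coincide. They coincide if the centre or the radius
  of \<open>C_mu\<close> vanishes (for instance if \<open>\<rho> = 0\<close>), so being the maximiser excludes being the
  minimiser only when \<open>mu_l \<noteq> mu_s\<close>.\<close>

definition mu_s :: "complex ^ 'n \<Rightarrow> complex ^ 'n \<Rightarrow> complex ^ 'n \<Rightarrow> real \<Rightarrow> complex set" where
  "mu_s a0 ak w \<rho> = {\<mu>. is_arg_min cmod (\<lambda>z. z \<in> C_mu a0 ak w \<rho>) \<mu>}"

definition mu_l :: "complex ^ 'n \<Rightarrow> complex ^ 'n \<Rightarrow> complex ^ 'n \<Rightarrow> real \<Rightarrow> complex set" where
  "mu_l a0 ak w \<rho> = {\<mu>. is_arg_max cmod (\<lambda>z. z \<in> C_mu a0 ak w \<rho>) \<mu>}"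

definition mu_star :: "complex ^ 'n \<Rightarrow> complex ^ 'n \<Rightarrow> complex ^ 'n \<Rightarrow> real \<Rightarrow> complex set" where
  "mu_star a0 ak w \<rho> = mu_s a0 ak w \<rho>"

lemma houter_mult_vec: "houter x y *v w = hdot y w *s x"
  by (simp add: houter_def hdot_def matrix_vector_mult_def vec_eq_iff sum_distrib_left mult_ac)

lemma w_par_eq: "w_par ak w = (hdot ak w / hdot ak ak) *s ak"
  by (simp add: w_par_def houter_mult_vec vec_eq_iff)

lemma T_map_update: "w_perp ak w + \<beta> *s w_par ak w = w + T_map ak w \<beta> *s ak"
  by (simp add: w_perp_def w_par_eq T_map_def vec_eq_iff algebra_simps diff_divide_distrib)

lemma norm_real2: "norm (v :: real ^ 2) = cmod (to_complex v)"
  by (simp add: norm_vec_def L2_set_def sum_2 to_complex_def cmod_def)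

lemma circle_set_eq:
  "circle_set H = {z. cmod (z - to_complex (circle_center H)) = circle_radius H}"
proof -
  have "to_complex (vector [Re z, Im z] - v) = z - to_complex v" for z :: complex and v
    by (simp add: to_complex_def complex_eq_iff)
  then show ?thesis
    by (simp add: circle_set_def norm_real2)
qed

lemma hdot_diff_left: "hdot (x - y) z = hdot x z - hdot y z"
  by (simp add: hdot_def sum_subtractf algebra_simps)

lemma hdot_scale_left: "hdot (c *s x) z = cnj c * hdot x z"
  by (simp add: hdot_def sum_distrib_left mult_ac)

lemma cnj_hdot: "cnj (hdot x y) = hdot y x"
  by (simp add: hdot_def mult.commute)

lemma w_perp_orth: "hdot (w_perp ak w) ak = 0"
proof (cases "hdot ak ak = 0")
  case True
  have "hdot ak ak = complex_of_real (\<Sum>i\<in>UNIV. (cmod (ak $ i))\<^sup>2)"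
    unfolding hdot_def of_real_sum
    by (intro sum.cong refl) (simp only: complex_norm_square mult.commute)
  with True have "(\<Sum>i\<in>UNIV. (cmod (ak $ i))\<^sup>2) = 0"
    by (metis of_real_eq_0_iff)
  then have "\<forall>i. ak $ i = 0"
    by (subst (asm) sum_nonneg_eq_0_iff) auto
  then show ?thesis by (simp add: hdot_def)
next
  case False
  then show ?thesis
    by (simp add: w_perp_def w_par_eq hdot_diff_left hdot_scale_left cnj_hdot)
qed

lemma det_B_mat:
  "det (B_mat a0 ak w \<rho>) =
    complex_of_real (- \<rho> * (cmod (hdot (w_perp ak w) a0))\<^sup>2 * (cmod (hdot (w_par ak w) ak))\<^sup>2)"
proof -
  have "complex_of_real (- \<rho> * (cmod x)\<^sup>2 * (cmod y)\<^sup>2) = - of_real \<rho> * (x * cnj x) * (y * cnj y)"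
    for x y
    by (simp only: of_real_mult of_real_minus complex_norm_square)
  then show ?thesis
    unfolding B_mat_def Let_def det_2 houter_def
    by (simp only:) (simp add: w_perp_orth, simp add: scaleR_conv_of_real algebra_simps)
qed

lemma R_beta_nonneg: "0 \<le> \<rho> \<Longrightarrow> 0 \<le> R_beta a0 ak w \<rho>"
  by (simp add: R_beta_def circle_radius_def det_B_mat)

lemma beta_star_is_arg_max:
  assumes "0 \<le> \<rho>"
  shows "is_arg_max cmod (\<lambda>z. z \<in> C_beta a0 ak w \<rho>) (beta_star a0 ak w \<rho>)"
proof -
  define c where "c = to_complex (c_beta a0 ak w \<rho>)"
  define R where "R = R_beta a0 ak w \<rho>"
  have R: "0 \<le> R" using R_beta_nonneg[OF assms] by (simp add: R_def)
  have C: "z \<in> C_beta a0 ak w \<rho> \<longleftrightarrow> cmod (z - c) = R" for z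
    by (simp add: C_beta_def circle_set_eq c_def R_def c_beta_def R_beta_def)
  have b: "beta_star a0 ak w \<rho> = complex_of_real (cmod c + R) * cis (Arg c)"
    by (simp add: beta_star_def c_def R_def norm_real2 cis_conv_exp)
  have c: "c = complex_of_real (cmod c) * cis (Arg c)"
    by (metis rcis_cmod_Arg rcis_def)
  have "beta_star a0 ak w \<rho> - c = complex_of_real R * cis (Arg c)"
    using c by (simp add: b algebra_simps)
  then have 1: "cmod (beta_star a0 ak w \<rho> - c) = R"
    using R by (simp add: norm_mult)
  have 2: "cmod (beta_star a0 ak w \<rho>) = cmod c + R"
    unfolding b norm_mult norm_of_real using R by simp
  have "cmod z \<le> cmod c + R" if "cmod (z - c) = R" for z
    using norm_triangle_sub[of z c] that by simp
  then show ?thesis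
    unfolding is_arg_max_def C using 1 2 by (auto simp: not_less)
qed

lemma circle_extremal_unique:
  fixes c z :: complex and s :: real
  assumes "c \<noteq> 0" "cmod (z - c) = \<bar>s\<bar>" "cmod z = \<bar>cmod c + s\<bar>"
  shows "z = (1 + s / cmod c) *\<^sub>R c"
proof -
  let ?p = "(1 + s / cmod c) *\<^sub>R c"
  have n: "cmod c > 0" using assms by simp
  have p1: "1 + s / cmod c = (cmod c + s) / cmod c" using n by (simp add: field_simps)
  have "(cmod (z - c))\<^sup>2 = (cmod z)\<^sup>2 - 2 * (z \<bullet> c) + (cmod c)\<^sup>2"
    by (simp add: power2_norm_eq_inner inner_diff_left inner_diff_right inner_commute)
  then have zc: "z \<bullet> c = cmod c * (cmod c + s)"
    unfolding assms(2,3) power2_abs by (simp add: power2_eq_square algebra_simps)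
  have "(cmod (z - t *\<^sub>R c))\<^sup>2 = (cmod z)\<^sup>2 - 2 * (t * (z \<bullet> c)) + t\<^sup>2 * (cmod c)\<^sup>2" for t
    unfolding power2_norm_eq_inner
    by (simp add: inner_diff_left inner_diff_right inner_commute power2_eq_square)
  then have "(cmod (z - ?p))\<^sup>2 =
      (cmod z)\<^sup>2 - 2 * ((1 + s / cmod c) * (z \<bullet> c)) + (1 + s / cmod c)\<^sup>2 * (cmod c)\<^sup>2" .
  also have "\<dots> = 0"
    unfolding zc assms(3) power2_abs p1 using n by (simp add: power2_eq_square)
  finally show ?thesis by simp
qed

lemma mu_s_mu_l_singletons:
  assumes "mu_s a0 ak w \<rho> \<noteq> mu_l a0 ak w \<rho>"
  obtains x y where "mu_s a0 ak w \<rho> = {x}" "mu_l a0 ak w \<rho> = {y}" "x \<noteq> y"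
proof -
  define c where "c = to_complex (circle_center (Q_mat a0 ak w \<rho>))"
  define R where "R = circle_radius (Q_mat a0 ak w \<rho>)"
  let ?C = "\<lambda>z. cmod (z - c) = R"
  have S: "mu_s a0 ak w \<rho> = {z. ?C z \<and> (\<forall>y. ?C y \<longrightarrow> cmod z \<le> cmod y)}"
    by (auto simp: mu_s_def C_mu_def circle_set_eq is_arg_min_def c_def R_def not_less)
  have L: "mu_l a0 ak w \<rho> = {z. ?C z \<and> (\<forall>y. ?C y \<longrightarrow> cmod y \<le> cmod z)}"
    by (auto simp: mu_l_def C_mu_def circle_set_eq is_arg_max_def c_def R_def not_less)
  have c0: "c \<noteq> 0" using assms unfolding S L by auto
  have "R \<noteq> 0" using assms unfolding S L by auto
  moreover have "\<not> R < 0" using assms norm_ge_zero unfolding S L by (smt (verit) Collect_cong)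
  ultimately have R: "R > 0" by simp
  define p where "p s = (1 + s / cmod c) *\<^sub>R c" for s :: real
  have n: "cmod c > 0" using c0 by simp
  have p: "cmod (p s - c) = \<bar>s\<bar>" "cmod (p s) = \<bar>cmod c + s\<bar>" for s
  proof -
    have "p s - c = (s / cmod c) *\<^sub>R c" by (simp add: p_def algebra_simps)
    then show "cmod (p s - c) = \<bar>s\<bar>" using n by simp
    have "1 + s / cmod c = (cmod c + s) / cmod c" using n by (simp add: field_simps)
    then show "cmod (p s) = \<bar>cmod c + s\<bar>" unfolding p_def using n by simp
  qed
  have lo: "\<bar>cmod c + - R\<bar> \<le> cmod z" and hi: "cmod z \<le> \<bar>cmod c + R\<bar>" if "?C z" for z
    using that norm_triangle_ineq2[of c z] norm_triangle_ineq2[of z c] norm_triangle_ineq2[of "z - c" z] norm_triangle_ineq2[of z "z - c"] norm_triangle_ineq3[of "z - c" "- c"] R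
    by (auto simp: norm_minus_commute)
  have C: "?C (p R)" "?C (p (- R))" using p R by auto
  have u: "z = p s" if "?C z" "cmod z = \<bar>cmod c + s\<bar>" "\<bar>s\<bar> = R" for z s
    unfolding p_def by (rule circle_extremal_unique) (use c0 that in auto)
  have "mu_s a0 ak w \<rho> = {p (- R)}"
  proof -
    have "cmod z = \<bar>cmod c + - R\<bar>" if "?C z" "\<forall>y. ?C y \<longrightarrow> cmod z \<le> cmod y" for z
      using that lo[of z] C(2) p(2)[of "- R"] by (metis order_antisym)
    then have "z = p (- R)" if "?C z" "\<forall>y. ?C y \<longrightarrow> cmod z \<le> cmod y" for z
      using that u[of z "- R"] R by simp
    moreover have "cmod (p (- R)) \<le> cmod y" if "?C y" for y
      using lo[OF that] p(2)[of "- R"] by simp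
    ultimately show ?thesis unfolding S using C(2) by blast
  qed
  moreover have "mu_l a0 ak w \<rho> = {p R}"
  proof -
    have "cmod z = \<bar>cmod c + R\<bar>" if "?C z" "\<forall>y. ?C y \<longrightarrow> cmod y \<le> cmod z" for z
      using that hi[of z] C(1) p(2)[of R] by (metis order_antisym)
    then have "z = p R" if "?C z" "\<forall>y. ?C y \<longrightarrow> cmod y \<le> cmod z" for z
      using that u[of z R] R by simp
    moreover have "cmod y \<le> cmod (p R)" if "?C y" for y
      using hi[OF that] p(2)[of R] by simp
    ultimately show ?thesis unfolding L using C(1) by blast
  qed
  moreover have "p (- R) \<noteq> p R"
    using c0 R by (simp add: p_def)
  ultimately show ?thesis using that by blast
qed

end

theory Submission
  imports Defs
begin

text \<open>Write \<open>\<alpha> = a\<^sub>k\<^sup>H w / a\<^sub>k\<^sup>H a\<^sub>k\<close>. The map \<open>T \<beta> = \<alpha> (\<beta> - 1)\<close> is a similarity that carries the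
  circle \<open>C_beta\<close> (centre \<open>c\<close>, radius \<open>R\<close>) onto \<open>C_mu\<close>, so the extremal points of \<open>C_mu\<close> correspond
  to the points of \<open>C_beta\<close> nearest to and farthest from \<open>1\<close>. Since \<open>beta_star = c + R v\<close> with \<open>v\<close> the
  direction of \<open>c\<close>, it is nearest to \<open>1\<close> iff \<open>v\<close> is opposite to the direction of \<open>c - 1\<close>, and
  farthest iff it agrees with it; as \<open>c - (c - 1) = 1\<close>, both force \<open>c\<close> to be real. A circle of radius
  \<open>0\<close> has centre \<open>0\<close> here, so the degenerate case agrees with the claim.\<close>

section \<open>Extremal points of a circle and of its image under multiplication by a complex
  number\<close>

lemma is_arg_min_circle_iff:
  fixes m v :: complex
  assumes "r > 0" "cmod v = 1"
  shows "is_arg_min cmod (\<lambda>z. cmod (z - m) = r) (m + of_real r * v) \<longleftrightarrow> of_real (cmod m) * v = - m"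
proof (cases "m = 0")
  \<comment> \<open>Around the origin every point is extremal. The direction condition carries the
    factor \<open>cmod m\<close> instead of a quotient, so here it reads
    \<open>0 = 0\<close>.\<close>
  case True
  with assms show ?thesis by (auto simp: is_arg_min_def norm_mult)
next
  case False
  let ?z = "m + of_real r * v"
  have z: "cmod (?z - m) = r" using assms by (simp add: norm_mult)
  have lower: "\<bar>cmod m - r\<bar> \<le> cmod y" if "cmod (y - m) = r" for y
    using norm_triangle_ineq3[of m "m - y"] that by (simp add: norm_minus_commute)
  show ?thesis
  proof
    \<comment> \<open>The competitor \<open>?p\<close> is reached from \<open>m\<close> by moving
      the distance \<open>r\<close> towards the origin; it attains the bound
      \<open>lower\<close>.\<close>
    let ?p = "(1 - r / cmod m) *\<^sub>R m"
    assume min: "is_arg_min cmod (\<lambda>z. cmod (z - m) = r) ?z"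
    have "?p - m = - ((r / cmod m) *\<^sub>R m)" by (simp add: algebra_simps)
    then have "cmod (?p - m) = r" using assms False by simp
    with min have "cmod ?z \<le> cmod ?p" by (auto simp: is_arg_min_def not_less)
    also have "cmod ?p = \<bar>cmod m - r\<bar>"
    proof -
      have "1 - r / cmod m = (cmod m - r) / cmod m" using False by (simp add: field_simps)
      then show ?thesis using False by simp
    qed
    \<comment> \<open>The sum with \<open>- r\<close> fits \<open>circle_extremal_unique\<close> at
      \<open>s = - r\<close>, which leaves no second point with this modulus.\<close>
    finally have "cmod ?z = \<bar>cmod m + - r\<bar>" using lower[OF z] by simp
    then have "?z = (1 + - r / cmod m) *\<^sub>R m"
      using False z assms by (intro circle_extremal_unique) auto
    then have "of_real r * (of_real (cmod m) * v + m) = 0"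
      using False by (simp add: scaleR_conv_of_real field_simps)
    moreover have "r \<noteq> 0" using assms by simp
    ultimately show "of_real (cmod m) * v = - m"
      unfolding mult_eq_0_iff of_real_eq_0_iff eq_neg_iff_add_eq_0 by blast
  next
    assume v: "of_real (cmod m) * v = - m"
    then have "?z = of_real (r - cmod m) * v" by (simp add: left_diff_distrib)
    then have "cmod ?z = \<bar>cmod m - r\<bar>" using assms by (simp only: norm_mult norm_of_real) auto
    then show "is_arg_min cmod (\<lambda>z. cmod (z - m) = r) ?z"
      using lower z by (auto simp: is_arg_min_def not_less)
  qed
qed

text \<open>The bound is now the triangle inequality; for nonzero \<open>m\<close> it is attained
  only beyond \<open>m\<close> on the ray from the origin, which is the case \<open>s = r\<close> of
  \<open>circle_extremal_unique\<close>.\<close>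

lemma is_arg_max_circle_iff:
  fixes m v :: complex
  assumes "r > 0" "cmod v = 1"
  shows "is_arg_max cmod (\<lambda>z. cmod (z - m) = r) (m + of_real r * v) \<longleftrightarrow> of_real (cmod m) * v = m"
proof (cases "m = 0")
  case True
  with assms show ?thesis by (auto simp: is_arg_max_def norm_mult)
next
  case False
  let ?z = "m + of_real r * v"
  have z: "cmod (?z - m) = r" using assms by (simp add: norm_mult)
  have upper: "cmod y \<le> cmod m + r" if "cmod (y - m) = r" for y
    using norm_triangle_sub[of y m] that by simp
  show ?thesis
  proof
    let ?p = "(1 + r / cmod m) *\<^sub>R m"
    assume max: "is_arg_max cmod (\<lambda>z. cmod (z - m) = r) ?z"
    have "?p - m = (r / cmod m) *\<^sub>R m" by (simp add: algebra_simps)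
    then have "cmod (?p - m) = r" using assms False by simp
    with max have "cmod ?p \<le> cmod ?z" by (auto simp: is_arg_max_def not_less)
    moreover have "cmod ?p = cmod m + r"
    proof -
      have "1 + r / cmod m = (cmod m + r) / cmod m" using False by (simp add: field_simps)
      then show ?thesis using False assms by simp
    qed
    ultimately have "cmod ?z = \<bar>cmod m + r\<bar>" using upper[OF z] assms by simp
    then have "?z = (1 + r / cmod m) *\<^sub>R m"
      using False z assms by (intro circle_extremal_unique) auto
    then show "of_real (cmod m) * v = m"
      using assms False by (simp add: scaleR_conv_of_real field_simps)
  next
    assume v: "of_real (cmod m) * v = m"
    then have "?z = of_real (cmod m + r) * v" by (simp add: algebra_simps)
    then have "cmod ?z = cmod m + r" using assms by (simp only: norm_mult norm_of_real) auto
    then show "is_arg_max cmod (\<lambda>z. cmod (z - m) = r) ?z"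
      using upper z by (auto simp: is_arg_max_def not_less)
  qed
qed

text \<open>Splits \<open>\<alpha>\<close> into its modulus, which scales the radius, and its phase,
  which turns the unit direction. This is the form that the two circle criteria expect.\<close>

lemma similar_circle_point:
  assumes "\<alpha> \<noteq> 0"
  shows "\<alpha> * (d + of_real R * v) = \<alpha> * d + of_real (cmod \<alpha> * R) * (sgn \<alpha> * v)"
  using assms by (simp add: sgn_div_norm scaleR_conv_of_real field_simps)

text \<open>The factor \<open>\<alpha>\<close> cancels from the direction condition, because
  \<open>cmod \<alpha>\<close> times \<open>sgn \<alpha>\<close> is \<open>\<alpha>\<close>.
  Extremality on the image circle thus becomes a condition on \<open>d\<close> and \<open>v\<close>
  alone.\<close>

lemma is_arg_min_similar_circle_iff:
  fixes \<alpha> d v :: complex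
  assumes "\<alpha> \<noteq> 0" "R > 0" "cmod v = 1"
  shows "is_arg_min cmod (\<lambda>z. cmod (z - \<alpha> * d) = cmod \<alpha> * R) (\<alpha> * (d + of_real R * v))
    \<longleftrightarrow> of_real (cmod d) * v = - d"
proof -
  have "of_real (cmod (\<alpha> * d)) * (sgn \<alpha> * v) = \<alpha> * (of_real (cmod d) * v)"
    using assms(1) by (simp add: sgn_div_norm scaleR_conv_of_real norm_mult field_simps)
  then have "of_real (cmod (\<alpha> * d)) * (sgn \<alpha> * v) = - (\<alpha> * d) \<longleftrightarrow> of_real (cmod d) * v = - d"
    using assms(1) by (metis mult_cancel_left mult_minus_right)
  moreover have "is_arg_min cmod (\<lambda>z. cmod (z - \<alpha> * d) = cmod \<alpha> * R)
      (\<alpha> * d + of_real (cmod \<alpha> * R) * (sgn \<alpha> * v))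
    \<longleftrightarrow> of_real (cmod (\<alpha> * d)) * (sgn \<alpha> * v) = - (\<alpha> * d)"
    using assms by (intro is_arg_min_circle_iff) (simp_all add: norm_mult norm_sgn)
  ultimately show ?thesis
    unfolding similar_circle_point[OF assms(1)] by simp
qed

lemma is_arg_max_similar_circle_iff:
  fixes \<alpha> d v :: complex
  assumes "\<alpha> \<noteq> 0" "R > 0" "cmod v = 1"
  shows "is_arg_max cmod (\<lambda>z. cmod (z - \<alpha> * d) = cmod \<alpha> * R) (\<alpha> * (d + of_real R * v))
    \<longleftrightarrow> of_real (cmod d) * v = d"
proof -
  have "of_real (cmod (\<alpha> * d)) * (sgn \<alpha> * v) = \<alpha> * (of_real (cmod d) * v)"
    using assms(1) by (simp add: sgn_div_norm scaleR_conv_of_real norm_mult field_simps)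
  then have "of_real (cmod (\<alpha> * d)) * (sgn \<alpha> * v) = \<alpha> * d \<longleftrightarrow> of_real (cmod d) * v = d"
    using assms(1) by (metis mult_cancel_left)
  moreover have "is_arg_max cmod (\<lambda>z. cmod (z - \<alpha> * d) = cmod \<alpha> * R)
      (\<alpha> * d + of_real (cmod \<alpha> * R) * (sgn \<alpha> * v))
    \<longleftrightarrow> of_real (cmod (\<alpha> * d)) * (sgn \<alpha> * v) = \<alpha> * d"
    using assms by (intro is_arg_max_circle_iff) (simp_all add: norm_mult norm_sgn)
  ultimately show ?thesis
    unfolding similar_circle_point[OF assms(1)] by simp
qed

section \<open>Solving the two direction conditions for the centre \<open>c\<close>\<close>

lemma unit_real_multiple_eq_1:
  assumes "cmod v = 1" "of_real t * v = 1"
  shows "v = of_real t" "t = 1 \<or> t = -1"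
proof -
  have "\<bar>t\<bar> * cmod v = 1" using assms(2) by (metis norm_mult norm_of_real norm_one)
  then have t: "\<bar>t\<bar> = 1" using assms(1) by simp
  then show "t = 1 \<or> t = -1" by linarith
  from t have "t * t = 1" by (metis abs_mult_self_eq mult_1)
  then have "complex_of_real t * of_real t = 1" by (metis of_real_1 of_real_mult)
  then show "v = of_real t" using assms(2) by (metis mult.assoc mult_1 mult_1_right)
qed

text \<open>With \<open>v = cis (Arg c)\<close>, adding the polar form of \<open>c\<close> to the
  condition gives \<open>(cmod c + cmod (c - 1)) * v = 1\<close>. Hence \<open>v = 1\<close> and the
  distances from \<open>c\<close> to \<open>0\<close> and \<open>1\<close> add up to
  \<open>1\<close>, which describes the segment between them.\<close>

lemma cis_Arg_opposite_iff:
  "of_real (cmod (c - 1)) * cis (Arg c) = - (c - 1) \<longleftrightarrow> Im c = 0 \<and> Re c \<in> {0..1}"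
proof
  assume *: "of_real (cmod (c - 1)) * cis (Arg c) = - (c - 1)"
  have c: "c = of_real (cmod c) * cis (Arg c)" by (metis rcis_cmod_Arg rcis_def)
  define t where "t = cmod c + cmod (c - 1)"
  have "of_real t * cis (Arg c) = 1"
    using * c by (simp add: t_def algebra_simps)
  moreover have "t \<ge> 0" by (simp add: t_def)
  ultimately have "t = 1" "cis (Arg c) = 1"
    using unit_real_multiple_eq_1[OF norm_cis, of t "Arg c"] by auto
  then have "cmod c + cmod (c - 1) = 1" "cis (Arg c) = 1" by (simp_all add: t_def)
  then have "c = of_real (cmod c)" "cmod c \<le> 1"
    using c by (simp, smt (verit) norm_ge_zero)
  then show "Im c = 0 \<and> Re c \<in> {0..1}"
    by (metis Im_complex_of_real Re_complex_of_real atLeastAtMost_iff norm_ge_zero)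
next
  assume *: "Im c = 0 \<and> Re c \<in> {0..1}"
  then have c: "c = of_real (Re c)" by (simp add: complex_eq_iff)
  then have "Arg c = 0" using * by (metis Arg_of_real atLeastAtMost_iff not_less)
  moreover have "cmod (c - 1) = 1 - Re c" using * by (simp add: cmod_eq_Re)
  ultimately show "of_real (cmod (c - 1)) * cis (Arg c) = - (c - 1)"
    using * by (simp add: complex_eq_iff)
qed

text \<open>Here the polar form is subtracted, so the factor \<open>t\<close> is a difference of
  moduli and may have either sign: \<open>t = 1\<close> puts \<open>c\<close> to the right of
  \<open>1\<close>, \<open>t = -1\<close> to the left of \<open>0\<close>. The point
  \<open>c = 1\<close> is excluded because it satisfies the equation trivially.\<close>

lemma cis_Arg_aligned_iff:
  "of_real (cmod (c - 1)) * cis (Arg c) = c - 1 \<and> c \<noteq> 1 \<longleftrightarrow> Im c = 0 \<and> Re c \<in> {..<0} \<union> {1<..}"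
proof
  assume *: "of_real (cmod (c - 1)) * cis (Arg c) = c - 1 \<and> c \<noteq> 1"
  define t where "t = cmod c - cmod (c - 1)"
  have c: "c = of_real (cmod c) * cis (Arg c)" by (metis rcis_cmod_Arg rcis_def)
  have "of_real t * cis (Arg c) = 1"
    using * c by (simp add: t_def algebra_simps)
  note v = unit_real_multiple_eq_1[OF norm_cis this]
  have "c = of_real (cmod c * t)" using c unfolding v(1) by simp
  then have re: "Im c = 0" "Re c = cmod c * t"
    by (metis Im_complex_of_real, metis Re_complex_of_real)
  then have "c - 1 = of_real (Re c - 1)" by (simp add: complex_eq_iff)
  with * v(1) have "complex_of_real (cmod (c - 1) * t) = of_real (Re c - 1)" by simp
  then have re1: "Re c - 1 = cmod (c - 1) * t" by (simp only: of_real_eq_iff)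
  \<comment> \<open>The convention \<open>Arg 0 = 0\<close> would make the direction
    \<open>1\<close>, not \<open>-1\<close>.\<close>
  have "c \<noteq> 0" if "t = -1" using v that by (auto simp: Arg_zero)
  then have "Re c < 0" if "t = -1" using re that by simp
  moreover have "1 < Re c" if "t = 1"
  proof -
    have "0 < cmod (c - 1)" using * by simp
    moreover have "Re c - 1 = cmod (c - 1)" using re1 that by simp
    ultimately show ?thesis by linarith
  qed
  ultimately have "Re c \<in> {..<0} \<union> {1<..}" using v(2) by auto
  with re show "Im c = 0 \<and> Re c \<in> {..<0} \<union> {1<..}" by simp
next
  assume *: "Im c = 0 \<and> Re c \<in> {..<0} \<union> {1<..}"
  then have c: "c = of_real (Re c)" by (simp add: complex_eq_iff)
  have "cmod (c - 1) = \<bar>Re c - 1\<bar>" using * by (simp add: cmod_eq_Re)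
  moreover have "Arg c = (if Re c < 0 then pi else 0)" using c by (metis Arg_of_real)
  ultimately show "of_real (cmod (c - 1)) * cis (Arg c) = c - 1 \<and> c \<noteq> 1"
    using * by (auto simp: complex_eq_iff)
qed

section \<open>Matrices that are differences of two rank-one terms\<close>

lemma to_complex_circle_center: "to_complex (circle_center H) = - cnj (H $ 1 $ 2) / of_real (Re (H $ 2 $ 2))"
  by (simp add: to_complex_def circle_center_def complex_eq_iff Re_divide_of_real Im_divide_of_real)

text \<open>In the determinant the pure terms vanish, since \<open>houter b b\<close> and
  \<open>houter e e\<close> have rank at most one; the mixed terms combine to the squared modulus of
  the minor of \<open>b\<close> and \<open>e\<close>.\<close>

lemma houter_diff_components:
  fixes b e :: "complex ^ 2" and \<rho> :: real
  defines "H \<equiv> houter b b - \<rho> *\<^sub>R houter e e"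
  shows "H $ 1 $ 2 = b $ 1 * cnj (b $ 2) - of_real \<rho> * (e $ 1 * cnj (e $ 2))"
    and "H $ 2 $ 2 = of_real ((cmod (b $ 2))\<^sup>2 - \<rho> * (cmod (e $ 2))\<^sup>2)"
    and "det H = of_real (- \<rho> * (cmod (b $ 1 * e $ 2 - b $ 2 * e $ 1))\<^sup>2)"
  unfolding H_def det_2 of_real_diff of_real_mult of_real_minus complex_norm_square
  by (simp_all add: houter_def scaleR_conv_of_real[where 'a = complex]) (simp add: algebra_simps)

lemma htranspose_houter_mult:
  "htranspose A ** houter x y ** A = houter (htranspose A *v x) (htranspose A *v y)"
  by (simp add: htranspose_def houter_def matrix_matrix_mult_def matrix_vector_mult_def vec_eq_iff
      sum_distrib_left sum_distrib_right mult_ac)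

lemma htranspose_columns2_mult: "htranspose (columns2 x y) *v z = vector [hdot x z, hdot y z]"
  by (simp add: htranspose_def columns2_def hdot_def matrix_vector_mult_def vec_eq_iff forall_2)

text \<open>Congruence preserves the shape \<open>houter x y\<close>, so \<open>Q_mat\<close> gets
  the same form as \<open>B_mat\<close> and \<open>houter_diff_components\<close> serves
  both.\<close>

lemma Q_mat_eq:
  fixes a0 ak w :: "complex ^ 'n"
  shows "Q_mat a0 ak w \<rho> =
    houter (vector [hdot w ak, hdot ak ak]) (vector [hdot w ak, hdot ak ak])
      - \<rho> *\<^sub>R houter (vector [hdot w a0, hdot ak a0]) (vector [hdot w a0, hdot ak a0])"
proof -
  have "A ** (M - \<rho> *\<^sub>R N) ** C = A ** M ** C - \<rho> *\<^sub>R (A ** N ** C)"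
    for A :: "complex ^ 'n ^ 2" and M N :: "complex ^ 'n ^ 'n" and C :: "complex ^ 2 ^ 'n"
    by (simp add: matrix_matrix_mult_def vec_eq_iff sum_subtractf sum_distrib_left
        sum_distrib_right scaleR_conv_of_real[where 'a = complex] algebra_simps)
  then show ?thesis
    by (simp add: Q_mat_def htranspose_houter_mult htranspose_columns2_mult)
qed

section \<open>Comparison of the circles \<open>C_beta\<close> and \<open>C_mu\<close>\<close>

context
  fixes a0 ak w :: "complex ^ 'n" and \<rho> :: real and \<alpha> :: complex and n :: real
  assumes B22: "B_mat a0 ak w \<rho> $ 2 $ 2 \<noteq> 0"
  defines "\<alpha> \<equiv> hdot ak w / hdot ak ak"
    and "n \<equiv> Re (hdot ak ak)"
begin

lemma hdot_self: "hdot ak ak = of_real n"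
  using cnj_hdot[of ak ak] by (simp add: n_def complex_eq_iff)

lemma hdot_w_par: "hdot (w_par ak w) z = cnj \<alpha> * hdot ak z"
  by (simp add: w_par_eq hdot_scale_left \<alpha>_def)

lemma hdot_w: "hdot w z = hdot (w_perp ak w) z + cnj \<alpha> * hdot ak z"
  by (simp add: w_perp_def hdot_diff_left hdot_w_par)

lemma B22_eq: "B_mat a0 ak w \<rho> $ 2 $ 2 = of_real ((cmod \<alpha>)\<^sup>2 * (n\<^sup>2 - \<rho> * (cmod (hdot ak a0))\<^sup>2))"
  unfolding B_mat_def Let_def houter_diff_components
  by (simp add: hdot_w_par hdot_self norm_mult power_mult_distrib algebra_simps)

lemma B22_nonzero: "\<alpha> \<noteq> 0" "n\<^sup>2 - \<rho> * (cmod (hdot ak a0))\<^sup>2 \<noteq> 0" "n \<noteq> 0"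
proof -
  show "\<alpha> \<noteq> 0" "n\<^sup>2 - \<rho> * (cmod (hdot ak a0))\<^sup>2 \<noteq> 0" using B22 unfolding B22_eq of_real_eq_0_iff by auto
  \<comment> \<open>Division by \<open>0\<close> yields \<open>0\<close>, so \<open>n = 0\<close>
    would force \<open>\<alpha> = 0\<close>.\<close>
  then show "n \<noteq> 0" by (auto simp: \<alpha>_def hdot_self)
qed

lemma Q22_eq: "Q_mat a0 ak w \<rho> $ 2 $ 2 = of_real (n\<^sup>2 - \<rho> * (cmod (hdot ak a0))\<^sup>2)"
  unfolding Q_mat_eq houter_diff_components by (simp add: hdot_self)

text \<open>Orthogonality of \<open>w_perp\<close> to \<open>ak\<close> removes the first rank-one
  term from the off-diagonal entry; only the term with \<open>\<rho>\<close> remains.\<close>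

lemma c_beta_eq:
  "to_complex (c_beta a0 ak w \<rho>) =
    of_real \<rho> * cnj (hdot (w_perp ak w) a0) * hdot ak a0
      / (\<alpha> * of_real (n\<^sup>2 - \<rho> * (cmod (hdot ak a0))\<^sup>2))"
proof -
  have "of_real ((cmod \<alpha>)\<^sup>2 * q) = \<alpha> * cnj \<alpha> * complex_of_real q" for q
    by (simp only: of_real_mult complex_norm_square)
  note this[of "n\<^sup>2 - \<rho> * (cmod (hdot ak a0))\<^sup>2"]
  moreover have "B_mat a0 ak w \<rho> $ 1 $ 2
      = - (of_real \<rho> * hdot (w_perp ak w) a0 * \<alpha> * cnj (hdot ak a0))"
    unfolding B_mat_def Let_def houter_diff_components by (simp add: w_perp_orth hdot_w_par)
  ultimately show ?thesis
    unfolding c_beta_def to_complex_circle_center B22_eq Re_complex_of_real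
    using B22_nonzero(1) by (simp del: of_real_diff of_real_mult)
qed

text \<open>Splitting \<open>w\<close> into \<open>w_perp\<close> and \<open>w_par\<close>, the
  perpendicular part yields \<open>\<alpha>\<close> times the centre of \<open>C_beta\<close>, while
  the parallel part reproduces the denominator \<open>q\<close> with factor
  \<open>- \<alpha>\<close>. The latter is the shift by \<open>-1\<close>.\<close>

lemma center_C_mu:
  "to_complex (circle_center (Q_mat a0 ak w \<rho>)) = \<alpha> * (to_complex (c_beta a0 ak w \<rho>) - 1)"
proof -
  define x p and q :: complex where "x = hdot (w_perp ak w) a0" and "p = hdot ak a0"
    and "q = of_real (n\<^sup>2 - \<rho> * (cmod p)\<^sup>2)"
  have q: "q = (of_real n)\<^sup>2 - of_real \<rho> * (p * cnj p)"
    unfolding q_def of_real_diff of_real_mult complex_norm_square by simp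
  have "q \<noteq> 0" using B22_nonzero(2) unfolding q_def p_def by (metis of_real_eq_0_iff)
  have "to_complex (circle_center (Q_mat a0 ak w \<rho>))
      = - cnj (cnj \<alpha> * of_real n * of_real n - of_real \<rho> * ((x + cnj \<alpha> * p) * cnj p)) / q"
    unfolding to_complex_circle_center Q22_eq Re_complex_of_real q_def p_def x_def
    unfolding Q_mat_eq houter_diff_components
    by (simp add: hdot_w[of a0] hdot_w[of ak] w_perp_orth hdot_self)
  also have "\<dots> = (of_real \<rho> * cnj x * p - \<alpha> * q) / q"
    unfolding q by (simp add: power2_eq_square algebra_simps)
  also have "\<dots> = \<alpha> * (of_real \<rho> * cnj x * p / (\<alpha> * q) - 1)"
    using \<open>q \<noteq> 0\<close> B22_nonzero(1) by (simp add: field_simps)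
  finally show ?thesis unfolding c_beta_eq x_def p_def q_def .
qed

lemma R_beta_eq:
  "R_beta a0 ak w \<rho> = sqrt \<rho> * cmod (hdot (w_perp ak w) a0) * \<bar>n\<bar>
      / (cmod \<alpha> * \<bar>n\<^sup>2 - \<rho> * (cmod (hdot ak a0))\<^sup>2\<bar>)"
proof -
  have "sqrt (\<rho> * x\<^sup>2 * (cmod \<alpha> * \<bar>n\<bar>)\<^sup>2) / \<bar>(cmod \<alpha>)\<^sup>2 * q\<bar> = sqrt \<rho> * \<bar>x\<bar> * \<bar>n\<bar> / (cmod \<alpha> * \<bar>q\<bar>)"
    for x q
    using B22_nonzero(1) by (simp add: real_sqrt_mult abs_mult power2_eq_square)
  from this[of "cmod (hdot (w_perp ak w) a0)"] show ?thesis
    unfolding R_beta_def circle_radius_def B22_eq det_B_mat norm_of_real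
    by (simp add: hdot_w_par hdot_self norm_mult)
qed

text \<open>The parallel part of \<open>w\<close> is a multiple of \<open>ak\<close> and drops out
  of the minor, which leaves \<open>n\<close> times the product of \<open>w_perp\<close> with
  \<open>a0\<close>, up to sign.\<close>

lemma radius_C_mu: "circle_radius (Q_mat a0 ak w \<rho>) = cmod \<alpha> * R_beta a0 ak w \<rho>"
proof -
  have "Re (det (Q_mat a0 ak w \<rho>)) = - \<rho> * (cmod (of_real n * hdot (w_perp ak w) a0))\<^sup>2"
    unfolding Q_mat_eq houter_diff_components Re_complex_of_real
    by (simp add: hdot_w[of a0] hdot_w[of ak] w_perp_orth hdot_self algebra_simps norm_minus_commute)
  then show ?thesis
    unfolding circle_radius_def Q22_eq norm_of_real R_beta_eq using B22_nonzero(1)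
    by (simp add: norm_mult real_sqrt_mult)
qed

text \<open>Since \<open>n\<close> is nonzero, a vanishing radius requires \<open>\<rho> = 0\<close>
  or \<open>w_perp\<close> orthogonal to \<open>a0\<close>, and both quantities are also factors of
  the centre.\<close>

lemma R_beta_0_imp_c_beta_0:
  assumes "R_beta a0 ak w \<rho> = 0"
  shows "to_complex (c_beta a0 ak w \<rho>) = 0"
  using assms B22_nonzero unfolding R_beta_eq c_beta_eq by auto

section \<open>The image of \<open>beta_star\<close> among the extremal points of
  \<open>C_mu\<close>\<close>

lemma T_map_eq: "T_map ak w \<beta> = \<alpha> * (\<beta> - 1)"
  by (simp add: T_map_def \<alpha>_def)

lemma C_mu_eq:
  "z \<in> C_mu a0 ak w \<rho> \<longleftrightarrow>
    cmod (z - \<alpha> * (to_complex (c_beta a0 ak w \<rho>) - 1)) = cmod \<alpha> * R_beta a0 ak w \<rho>"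
  by (simp add: C_mu_def circle_set_eq center_C_mu radius_C_mu)

lemma beta_star_eq:
  defines "c \<equiv> to_complex (c_beta a0 ak w \<rho>)"
  shows "beta_star a0 ak w \<rho> = c + of_real (R_beta a0 ak w \<rho>) * cis (Arg c)"
proof -
  have "c = of_real (cmod c) * cis (Arg c)" by (metis rcis_cmod_Arg rcis_def)
  then show ?thesis
    by (simp add: beta_star_def c_def norm_real2 cis_conv_exp algebra_simps)
qed

lemma T_map_beta_star:
  defines "c \<equiv> to_complex (c_beta a0 ak w \<rho>)"
  shows "T_map ak w (beta_star a0 ak w \<rho>)
    = \<alpha> * (c - 1 + of_real (R_beta a0 ak w \<rho>) * cis (Arg c))"
  by (simp add: T_map_eq beta_star_eq c_def algebra_simps)

lemma degenerate_C_mu: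
  assumes "R_beta a0 ak w \<rho> = 0"
  shows "mu_s a0 ak w \<rho> = {T_map ak w (beta_star a0 ak w \<rho>)}"
    and "mu_l a0 ak w \<rho> = {T_map ak w (beta_star a0 ak w \<rho>)}"
  unfolding mu_s_def mu_l_def C_mu_eq T_map_beta_star assms
  by (auto simp: is_arg_min_def is_arg_max_def)

lemma T_map_beta_star_in_mu_s_iff:
  defines "c \<equiv> to_complex (c_beta a0 ak w \<rho>)"
  assumes "0 \<le> \<rho>"
  shows "T_map ak w (beta_star a0 ak w \<rho>) \<in> mu_s a0 ak w \<rho> \<longleftrightarrow> Im c = 0 \<and> Re c \<in> {0..1}"
proof (cases "R_beta a0 ak w \<rho> = 0")
  case True
  \<comment> \<open>Both sides are true: \<open>C_mu\<close> is a single point and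
    \<open>c = 0\<close> lies in the unit interval.\<close>
  then show ?thesis
    by (simp add: degenerate_C_mu R_beta_0_imp_c_beta_0 c_def)
next
  case False
  then have "R_beta a0 ak w \<rho> > 0" using R_beta_nonneg[OF assms(2)] by (simp add: order_less_le)
  then show ?thesis
    unfolding mu_s_def mem_Collect_eq C_mu_eq T_map_beta_star c_def
    by (simp add: is_arg_min_similar_circle_iff[OF B22_nonzero(1)] cis_Arg_opposite_iff[simplified])
qed

lemma T_map_beta_star_in_mu_l_iff:
  defines "c \<equiv> to_complex (c_beta a0 ak w \<rho>)"
  assumes "0 \<le> \<rho>"
  shows "T_map ak w (beta_star a0 ak w \<rho>) \<in> mu_l a0 ak w \<rho> \<and> mu_l a0 ak w \<rho> \<noteq> mu_s a0 ak w \<rho>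
    \<longleftrightarrow> Im c = 0 \<and> Re c \<in> {..<0} \<union> {1<..}" (is "?L \<longleftrightarrow> ?P")
proof (cases "R_beta a0 ak w \<rho> = 0")
  case True
  \<comment> \<open>Both sides are false: the two extremal sets coincide and
    \<open>c = 0\<close>.\<close>
  then show ?thesis
    by (simp add: degenerate_C_mu R_beta_0_imp_c_beta_0 c_def)
next
  case False
  then have "R_beta a0 ak w \<rho> > 0" using R_beta_nonneg[OF assms(2)] by (simp add: order_less_le)
  then have l: "T_map ak w (beta_star a0 ak w \<rho>) \<in> mu_l a0 ak w \<rho>
      \<longleftrightarrow> of_real (cmod (c - 1)) * cis (Arg c) = c - 1"
    unfolding mu_l_def mem_Collect_eq C_mu_eq T_map_beta_star c_def
    by (simp add: is_arg_max_similar_circle_iff[OF B22_nonzero(1)])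
  show ?thesis
  proof
    assume ?L
    \<comment> \<open>For \<open>c = 1\<close> the circle \<open>C_mu\<close> is centred at the
      origin, so all its points have the same modulus.\<close>
    have "mu_l a0 ak w \<rho> = mu_s a0 ak w \<rho>" if "c = 1"
      using that unfolding mu_l_def mu_s_def C_mu_eq c_def
      by (auto simp: is_arg_max_def is_arg_min_def)
    with \<open>?L\<close> l show ?P using cis_Arg_aligned_iff by blast
  next
    assume ?P
    \<comment> \<open>The ranges of \<open>Re c\<close> in the two criteria are disjoint, so a
      maximiser found here is no minimiser and the two sets differ.\<close>
    then have "T_map ak w (beta_star a0 ak w \<rho>) \<notin> mu_s a0 ak w \<rho>"
      using T_map_beta_star_in_mu_s_iff[OF assms(2)] by (auto simp: c_def)
    with \<open>?P\<close> show ?L using cis_Arg_aligned_iff l by blast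
  qed
qed

lemma beta_star_real:
  assumes "c_beta a0 ak w \<rho> $ 2 = 0"
  shows "beta_star a0 ak w \<rho> \<in> \<real>"
proof -
  have "to_complex (c_beta a0 ak w \<rho>) = of_real (c_beta a0 ak w \<rho> $ 1)"
    using assms by (simp add: to_complex_def complex_eq_iff)
  then show ?thesis unfolding beta_star_eq by (simp add: Arg_of_real)
qed

end

theorem proposition4:
  fixes g :: "'n::finite \<Rightarrow> real \<Rightarrow> complex"
    and \<tau> :: "'n \<Rightarrow> real \<Rightarrow> real"
    and \<omega> \<theta>0 \<theta>k \<rho> :: real
    and a0 ak w :: "complex ^ 'n"
  assumes "a0 = steering g \<tau> \<omega> \<theta>0"
    and "ak = steering g \<tau> \<omega> \<theta>k"
    and "\<rho> \<in> {0..1}"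
    and "B_mat a0 ak w \<rho> $ 2 $ 2 \<noteq> 0"
  shows
    "(T_map ak w (beta_star a0 ak w \<rho>) \<in> mu_s a0 ak w \<rho> \<and> mu_s a0 ak w \<rho> = mu_star a0 ak w \<rho>
        \<longleftrightarrow> c_beta a0 ak w \<rho> $ 2 = 0 \<and> c_beta a0 ak w \<rho> $ 1 \<in> {0..1})
     \<and> (T_map ak w (beta_star a0 ak w \<rho>) \<in> mu_l a0 ak w \<rho> \<and> mu_l a0 ak w \<rho> \<noteq> mu_s a0 ak w \<rho>
        \<longleftrightarrow> c_beta a0 ak w \<rho> $ 2 = 0 \<and> c_beta a0 ak w \<rho> $ 1 \<in> {..<0} \<union> {1<..})
     \<and> (T_map ak w (beta_star a0 ak w \<rho>) \<in> mu_s a0 ak w \<rho> \<union> mu_l a0 ak w \<rho>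
        \<longrightarrow> beta_star a0 ak w \<rho> \<in> \<real>)"
proof -
  let ?c = "to_complex (c_beta a0 ak w \<rho>)"
  have \<rho>: "0 \<le> \<rho>" using assms(3) by simp
  have c: "Re ?c = c_beta a0 ak w \<rho> $ 1" "Im ?c = c_beta a0 ak w \<rho> $ 2"
    by (simp_all add: to_complex_def)
  note s = T_map_beta_star_in_mu_s_iff[OF assms(4) \<rho>, unfolded c]
    and l = T_map_beta_star_in_mu_l_iff[OF assms(4) \<rho>, unfolded c]
    and r = beta_star_real[OF assms(4)]
  \<comment> \<open>For the third claim, a point of \<open>mu_l\<close> outside \<open>mu_s\<close>
    shows that the sets differ, so \<open>s\<close> or \<open>l\<close> always applies and makes the
    centre real.\<close>
  from s l r show ?thesis unfolding mu_star_def by blast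
qed

end
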